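(* Let $T : X \to X$ be a measure-preserving transformation of a probability space $(X, \mathcal{B}, \mu)$, let $\Phi : X \to X$ be a scaling involution with scaling ratio $\rho > 1$, let $F = \Phi T$ be their composition, and let $\widetilde{F} : X \times \mathbb{Z} \to X \times \mathbb{Z}$ be the corresponding discrete Maharam extension with measure $\widetilde{\mu}$. Then $\widetilde{F}$ is $\widetilde{\mu}$-ergodic if and only if $F$ is ergodic (with respect to $\mu$) and of Krieger type $III_{1/\rho}$.
   Context: Conventions: $(X,\mathcal{B},\mu)$ is a non-atomic probability space. All definitions and set equalities are up to null sets. All maps are measurable bijections (after discarding a null set) for which images and preimages of measurable sets are measurable. A measure-preserving transformation $T:X\to X$ is a measurable bijection with $\mu(T(E))=\mu(E)$ for all measurable $E$. Scaling involution: a measurable bijection $\Phi:X\to X$ with $\Phi^2=\mathrm{id}$ for which there is a set $S$ of positive measure such that $X=S\sqcup\Phi(S)$, $\mu(S)<\mu(\Phi(S))$, and $\mu(\Phi(E))=\rho\,\mu(E)$ for every measurable $E\subseteq S$, where $\rho=\mu(\Phi(S))/\mu(S)>1$ is the scaling ratio. (Hence $\mu(\Phi(E))=\rho^{-1}\mu(E)$ for measurable $E\subseteq\Phi(S)$.) The map $F=\Phi T$ is called a reciprocal transformation; it is non-singular, i.e. $\mu(E)=0$ iff $\mu(F(E))=0$. Discrete Maharam extension: let $\pi:X\times\mathbb{Z}\to X$ be the projection. On $X\times\mathbb{Z}$, with the product of $\mathcal{B}$ and the power set of $\mathbb{Z}$, put $$\widetilde{\mu}(E)=\sum_{n\in\mathbb{Z}}\rho^{-n}\mu\big(\pi(E_n)\big),\qquad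 E_n=E\cap(X\times\{n\}),$$ and define $\widetilde{F}(x,n)=(F(x),n+1)$ if $x\in T^{-1}(S)$ and $\widetilde{F}(x,n)=(F(x),n-1)$ if $x\in T^{-1}(\Phi(S))$. Ergodicity: a measurable set $E$ is invariant under a transformation $G$ if $G(E)=E$ up to a null set; $G$ is ergodic with respect to a (finite or infinite) measure if every invariant measurable set $E$ is null or has null complement. Ratio set and type: for $n\in\mathbb{Z}$ let $\frac{dF^n_*\mu}{d\mu}$ denote the density $\omega_n$ with $\mu(F^n(E))=\int_E\omega_n\,d\mu$ for all measurable $E$. The ratio set $r(F)$ is the set of real numbers $\lambda\ge 0$ such that for every set $E$ of positive measure and every $\varepsilon>0$ there exist a subset $E'\subseteq E$ of positive measure and an integer $n$ such that for every $x\in E'$, $F^n(x)\in E$ and $\left|\frac{dF^n_*\mu}{d\mu}(x)-\lambda\right|<\varepsilon$. For $\lambda\in(0,1)$, an ergodic $F$ has Krieger type $III_\lambda$ if $r(F)=\{0\}\cup\{\lambda^n : n\in\mathbb{Z}\}$. *)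

theory Defs
  imports "HOL-Probability.Probability"
begin

definition nonatomic :: "'a measure \<Rightarrow> bool" where
  "nonatomic M \<longleftrightarrow>
     (\<forall>A\<in>sets M. emeasure M A > 0 \<longrightarrow>
        (\<exists>B\<in>sets M. B \<subseteq> A \<and> 0 < emeasure M B \<and> emeasure M B < emeasure M A))"

text \<open>
  Maps are genuine bijections of the space: the null set outside of which a map is a bijection
  has already been removed from the space.  Equalities between maps and between sets, on the
  other hand, are only required modulo null sets below.
\<close>

definition bimeasurable_bij :: "'a measure \<Rightarrow> ('a \<Rightarrow> 'a) \<Rightarrow> bool" where
  "bimeasurable_bij M f \<longleftrightarrow>
     bij_betw f (space M) (space M) \<and> f \<in> M \<rightarrow>\<^sub>M M \<and> (\<forall>A\<in>sets M. f ` A \<in> sets M)"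

definition measure_preserving_transformation :: "'a measure \<Rightarrow> ('a \<Rightarrow> 'a) \<Rightarrow> bool" where
  "measure_preserving_transformation M T \<longleftrightarrow>
     bimeasurable_bij M T \<and> (\<forall>E\<in>sets M. emeasure M (T ` E) = emeasure M E)"

definition scaling_ratio :: "'a measure \<Rightarrow> ('a \<Rightarrow> 'a) \<Rightarrow> 'a set \<Rightarrow> real" where
  "scaling_ratio M \<Phi> S = measure M (\<Phi> ` S) / measure M S"

text \<open>
  The set \<open>S\<close> (the part of the space that \<open>\<Phi>\<close> expands) is determined by \<open>\<Phi>\<close> up to a null set;
  it is kept as an explicit parameter.
\<close>

definition scaling_involution :: "'a measure \<Rightarrow> ('a \<Rightarrow> 'a) \<Rightarrow> 'a set \<Rightarrow> bool" where
  "scaling_involution M \<Phi> S \<longleftrightarrow>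
     bimeasurable_bij M \<Phi> \<and>
     (AE x in M. \<Phi> (\<Phi> x) = x) \<and>
     S \<in> sets M \<and> measure M S > 0 \<and>
     S \<inter> \<Phi> ` S \<in> null_sets M \<and> space M - (S \<union> \<Phi> ` S) \<in> null_sets M \<and>
     measure M S < measure M (\<Phi> ` S) \<and>
     (\<forall>E\<in>sets M. E \<subseteq> S \<longrightarrow> measure M (\<Phi> ` E) = scaling_ratio M \<Phi> S * measure M E)"

definition reciprocal_transformation :: "('a \<Rightarrow> 'a) \<Rightarrow> ('a \<Rightarrow> 'a) \<Rightarrow> 'a \<Rightarrow> 'a" where
  "reciprocal_transformation \<Phi> T = \<Phi> \<circ> T"

text \<open>
  Ergodicity for a non-singular bijection of a finite or infinite measure space.
\<close>

definition ergodic :: "'a measure \<Rightarrow> ('a \<Rightarrow> 'a) \<Rightarrow> bool" where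
  "ergodic M G \<longleftrightarrow>
     (\<forall>E\<in>sets M. (G ` E - E) \<union> (E - G ` E) \<in> null_sets M \<longrightarrow>
        E \<in> null_sets M \<or> space M - E \<in> null_sets M)"

definition maharam_measure :: "'a measure \<Rightarrow> real \<Rightarrow> ('a \<times> int) measure" where
  "maharam_measure M \<rho> =
     measure_of (space M \<times> UNIV) (sets (M \<Otimes>\<^sub>M count_space UNIV))
       (\<lambda>E. \<integral>\<^sup>+ n. ennreal (\<rho> powi (- n)) * emeasure M (fst ` (E \<inter> (space M \<times> {n})))
              \<partial>count_space UNIV)"

text \<open>
  Since \<open>S\<close> and \<open>\<Phi> ` S\<close> partition the space up to a null set, the second case is, up to a null
  set, the case where \<open>T x\<close> lies in \<open>\<Phi> ` S\<close>.
\<close>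

definition maharam_extension ::
  "('a \<Rightarrow> 'a) \<Rightarrow> ('a \<Rightarrow> 'a) \<Rightarrow> 'a set \<Rightarrow> 'a \<times> int \<Rightarrow> 'a \<times> int" where
  "maharam_extension \<Phi> T S =
     (\<lambda>(x, n). (reciprocal_transformation \<Phi> T x, if T x \<in> S then n + 1 else n - 1))"

definition iterate_int :: "'a measure \<Rightarrow> ('a \<Rightarrow> 'a) \<Rightarrow> int \<Rightarrow> 'a \<Rightarrow> 'a" where
  "iterate_int M F n =
     (if n \<ge> 0 then F ^^ nat n else the_inv_into (space M) F ^^ nat (- n))"

text \<open>
  The density \<open>\<omega>\<^sub>n\<close> satisfies \<open>\<mu>(F\<^sup>n(E)) = \<integral>\<^sub>E \<omega>\<^sub>n d\<mu>\<close>.  As the set function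
  \<open>E \<mapsto> \<mu>(F\<^sup>n(E))\<close> is the image measure of \<open>\<mu>\<close> under the inverse map \<open>F\<^sup>-\<^sup>n\<close>, it appears below as
  \<open>distr\<close> along the iterate with exponent \<open>- n\<close>.
\<close>

definition iterate_density :: "'a measure \<Rightarrow> ('a \<Rightarrow> 'a) \<Rightarrow> int \<Rightarrow> 'a \<Rightarrow> real" where
  "iterate_density M F n x = enn2real (RN_deriv M (distr M M (iterate_int M F (- n))) x)"

definition ratio_set :: "'a measure \<Rightarrow> ('a \<Rightarrow> 'a) \<Rightarrow> real set" where
  "ratio_set M F =
     {r. r \<ge> 0 \<and>
        (\<forall>E\<in>sets M. emeasure M E > 0 \<longrightarrow>
          (\<forall>\<epsilon>>0. \<exists>E'\<in>sets M. \<exists>n::int. E' \<subseteq> E \<and> emeasure M E' > 0 \<and>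
             (\<forall>x\<in>E'. iterate_int M F n x \<in> E \<and> \<bar>iterate_density M F n x - r\<bar> < \<epsilon>)))}"

definition krieger_type_III :: "'a measure \<Rightarrow> ('a \<Rightarrow> 'a) \<Rightarrow> real \<Rightarrow> bool" where
  "krieger_type_III M F r \<longleftrightarrow>
     0 < r \<and> r < 1 \<and> ergodic M F \<and> ratio_set M F = {0} \<union> {r powi n | n :: int. True}"

text \<open>The set function in the definition of \<open>maharam_measure\<close> is indeed a measure:\<close>

lemma space_maharam_measure [simp]: "space (maharam_measure M \<rho>) = space M \<times> UNIV"
  unfolding maharam_measure_def
  using sets.space_closed[of "M \<Otimes>\<^sub>M count_space (UNIV :: int set)"]
  by (intro space_measure_of) (simp add: space_pair_measure)

lemma sets_maharam_measure [simp, measurable_cong]: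
  "sets (maharam_measure M \<rho>) = sets (M \<Otimes>\<^sub>M count_space UNIV)"
  unfolding maharam_measure_def
  using sets.sets_measure_of_eq[of "M \<Otimes>\<^sub>M count_space (UNIV :: int set)"]
  by (simp add: space_pair_measure)

lemma maharam_slice:
  assumes "E \<in> sets (M \<Otimes>\<^sub>M count_space (UNIV :: int set))"
  shows "fst ` (E \<inter> (space M \<times> {n})) = (\<lambda>x. (x, n)) -` E"
    and "(\<lambda>x. (x, n)) -` E \<in> sets M"
proof -
  have "E \<subseteq> space M \<times> UNIV"
    using sets.sets_into_space[OF assms] by (simp add: space_pair_measure)
  then show "fst ` (E \<inter> (space M \<times> {n})) = (\<lambda>x. (x, n)) -` E" by (auto intro!: rev_image_eqI)
  show "(\<lambda>x. (x, n)) -` E \<in> sets M" by (rule sets_Pair2[OF assms])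
qed

lemma emeasure_maharam_measure:
  assumes E: "E \<in> sets (M \<Otimes>\<^sub>M count_space UNIV)"
  shows "emeasure (maharam_measure M \<rho>) E =
    (\<integral>\<^sup>+ n. ennreal (\<rho> powi (- n)) * emeasure M (fst ` (E \<inter> (space M \<times> {n})))
       \<partial>count_space UNIV)"
proof (rule emeasure_measure_of[OF maharam_measure_def])
  let ?P = "M \<Otimes>\<^sub>M count_space (UNIV :: int set)"
  let ?m = "\<lambda>E. \<integral>\<^sup>+ n. ennreal (\<rho> powi (- n)) * emeasure M (fst ` (E \<inter> (space M \<times> {n})))
       \<partial>count_space UNIV"
  show "sets ?P \<subseteq> Pow (space M \<times> UNIV)"
    using sets.space_closed[of ?P] by (simp add: space_pair_measure)
  show "E \<in> sets (maharam_measure M \<rho>)" using E by simp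
  show "positive (sets (maharam_measure M \<rho>)) ?m" by (simp add: positive_def)
  show "countably_additive (sets (maharam_measure M \<rho>)) ?m"
    unfolding countably_additive_def
  proof (intro allI impI)
    fix A :: "nat \<Rightarrow> ('a \<times> int) set"
    assume A: "range A \<subseteq> sets (maharam_measure M \<rho>)" and d: "disjoint_family A"
      and U: "\<Union> (range A) \<in> sets (maharam_measure M \<rho>)"
    have Ai: "A i \<in> sets ?P" for i using A by auto
    have slice: "emeasure M (fst ` (\<Union> (range A) \<inter> (space M \<times> {n}))) =
        (\<Sum>i. emeasure M (fst ` (A i \<inter> (space M \<times> {n}))))" for n
    proof -
      have "(\<Sum>i. emeasure M ((\<lambda>x. (x, n)) -` A i)) = emeasure M (\<Union>i. (\<lambda>x. (x, n)) -` A i)"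
        using d by (intro suminf_emeasure) (auto simp: maharam_slice(2)[OF Ai] disjoint_family_on_def)
      moreover have "fst ` (\<Union> (range A) \<inter> (space M \<times> {n})) = (\<Union>i. (\<lambda>x. (x, n)) -` A i)"
        using U by (subst maharam_slice(1)) auto
      ultimately show ?thesis by (simp add: maharam_slice(1)[OF Ai])
    qed
    show "(\<Sum>i. ?m (A i)) = ?m (\<Union> (range A))"
      unfolding slice ennreal_suminf_cmult[symmetric]
      by (rule nn_integral_suminf[symmetric]) simp
  qed
qed

end

theory Submission
  imports Defs
begin

text \<open>
  Put \<open>F = \<Phi> \<circ> T\<close> and \<open>c x = 1\<close> if \<open>T x \<in> S\<close>, \<open>c x = - 1\<close> otherwise.  Since \<open>T\<close> preserves the
  measure, and \<open>\<Phi>\<close> multiplies it by \<open>\<rho>\<close> on \<open>S\<close> and by \<open>1 / \<rho>\<close> off \<open>S\<close>, the Jacobian of \<open>F\<close> is \<open>\<rho>\<close> to the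
  power \<open>c\<close>, and by the chain rule the Jacobian of \<open>F\<^sup>n\<close> is \<open>\<rho>\<close> to the power of the Birkhoff sum
  \<open>c\<^sub>n\<close> of \<open>c\<close> along the orbit.  The Maharam extension is the skew product
  \<open>G (x, m) = (F x, m + c x)\<close>, so that \<open>G\<^sup>n (x, m) = (F\<^sup>n x, m + c\<^sub>n x)\<close>: the second
  coordinate records the logarithm of the Jacobian.

  As the Jacobians take only values in the discrete set of powers of \<open>\<rho>\<close>, a power \<open>\<rho>\<^sup>k\<close> belongs to
  the ratio set iff \<open>k\<close> is an essential value of \<open>c\<close>, which means that every set \<open>E\<close> of positive
  measure contains a non-null set of points that some \<open>F\<^sup>n\<close> with \<open>c\<^sub>n = k\<close> returns to \<open>E\<close>; no other
  positive number belongs to the ratio set, and \<open>0\<close> belongs to it as soon as all powers do.  So type \<open>III\<close> with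
  parameter \<open>1 / \<rho>\<close> means that \<open>F\<close> is ergodic and that every integer is an essential value
  (\<open>krieger_type_III_iff\<close>).

  It remains to prove that \<open>G\<close> is ergodic iff \<open>F\<close> is ergodic and every integer is an essential value
  (\<open>ergodic_skew_product_iff\<close>).  If \<open>G\<close> is ergodic, the \<open>G\<close>-orbit of \<open>E \<times> {k}\<close> is a non-null invariant
  set, hence conull, hence it meets \<open>E \<times> {0}\<close>; this makes \<open>k\<close> an essential value.  Ergodicity of
  \<open>F\<close> follows by applying that of \<open>G\<close> to the sets \<open>E \<times> \<int>\<close>.  Conversely let \<open>A\<close> be \<open>G\<close>-invariant.
  If the set \<open>E\<close> of points \<open>x\<close> with \<open>(x, n) \<in> A\<close> but \<open>(x, n + k) \<notin> A\<close> were not null, a return to \<open>E\<close> with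
  \<open>c\<^sub>m = k\<close> would carry a non-null part of \<open>A\<close> out of \<open>A\<close>.  Hence all slices of \<open>A\<close> agree up to null
  sets; their common value is \<open>F\<close>-invariant, so it is null or conull, and so is \<open>A\<close>.
\<close>

section \<open>Bijections whose Jacobian is a power of a constant\<close>

text \<open>
  Here \<open>g\<close> is the inverse of \<open>f\<close> on the space, so \<open>distr M M g\<close> is the measure \<open>E \<mapsto> \<mu> (f E)\<close>, and its
  density is the Jacobian of \<open>f\<close>.  Carrying the inverse along as an argument makes the notion
  symmetric in \<open>f\<close> and \<open>g\<close> up to the sign of the exponent.
\<close>

definition log_jacobian ::
  "'a measure \<Rightarrow> real \<Rightarrow> ('a \<Rightarrow> 'a) \<Rightarrow> ('a \<Rightarrow> 'a) \<Rightarrow> ('a \<Rightarrow> int) \<Rightarrow> bool" where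
  "log_jacobian M \<rho> f g c \<longleftrightarrow>
     f \<in> M \<rightarrow>\<^sub>M M \<and> g \<in> M \<rightarrow>\<^sub>M M \<and>
     (\<forall>x\<in>space M. g (f x) = x \<and> f (g x) = x) \<and>
     c \<in> M \<rightarrow>\<^sub>M count_space UNIV \<and>
     distr M M g = density M (\<lambda>x. ennreal (\<rho> powi c x))"

lemma log_jacobianD:
  assumes "log_jacobian M \<rho> f g c"
  shows "f \<in> M \<rightarrow>\<^sub>M M" "g \<in> M \<rightarrow>\<^sub>M M" "c \<in> M \<rightarrow>\<^sub>M count_space UNIV"
    and "\<And>x. x \<in> space M \<Longrightarrow> g (f x) = x" "\<And>x. x \<in> space M \<Longrightarrow> f (g x) = x"
    and "distr M M g = density M (\<lambda>x. ennreal (\<rho> powi c x))"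
  using assms by (auto simp: log_jacobian_def)

lemma log_jacobian_id: "log_jacobian M \<rho> (\<lambda>x. x) (\<lambda>x. x) (\<lambda>x. 0)"
  by (simp add: log_jacobian_def density_1 distr_id2)

lemma log_jacobian_cong:
  assumes "\<And>x. x \<in> space M \<Longrightarrow> f x = f' x" "\<And>x. x \<in> space M \<Longrightarrow> g x = g' x"
    and "\<And>x. x \<in> space M \<Longrightarrow> c x = c' x"
  shows "log_jacobian M \<rho> f g c \<longleftrightarrow> log_jacobian M \<rho> f' g' c'"
proof -
  have *: "log_jacobian M \<rho> f' g' c'"
    if f: "log_jacobian M \<rho> f g c"
      and eq: "\<And>x. x \<in> space M \<Longrightarrow> f x = f' x" "\<And>x. x \<in> space M \<Longrightarrow> g x = g' x"
        "\<And>x. x \<in> space M \<Longrightarrow> c x = c' x"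
    for f g c f' g' c'
  proof -
    note f = log_jacobianD[OF f]
    have meas: "f' \<in> M \<rightarrow>\<^sub>M M" "g' \<in> M \<rightarrow>\<^sub>M M" "c' \<in> M \<rightarrow>\<^sub>M count_space UNIV"
      using f(1-3) eq measurable_cong[of M f f'] measurable_cong[of M g g']
        measurable_cong[of M c c'] by blast+
    note [measurable] = meas f(1-3)
    have "distr M M g' = distr M M g" by (intro distr_cong) (auto simp: eq)
    also have "\<dots> = density M (\<lambda>x. ennreal (\<rho> powi c' x))"
      unfolding f(6) by (intro density_cong) (auto simp: eq)
    finally show ?thesis
      using meas f(4,5) eq measurable_space[OF f(1)] measurable_space[OF f(2)]
      by (auto simp: log_jacobian_def)
  qed
  show ?thesis using *[of f g c f' g' c'] *[of f' g' c' f g c] assms by auto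
qed

lemma log_jacobian_the_inv_into:
  assumes "log_jacobian M \<rho> f g c"
  shows "log_jacobian M \<rho> f (the_inv_into (space M) f) c"
proof -
  note f = log_jacobianD[OF assms]
  have "inj_on f (space M)" by (rule inj_on_inverseI[of _ g]) (rule f)
  then have "the_inv_into (space M) f x = g x" if "x \<in> space M" for x
    using that f(5) measurable_space[OF f(2)] by (intro the_inv_into_f_eq) auto
  then show ?thesis using assms log_jacobian_cong[of M f f "the_inv_into (space M) f" g c c] by simp
qed

text \<open>The chain rule, in logarithmic form.\<close>

lemma log_jacobian_comp:
  assumes "0 < \<rho>" and f: "log_jacobian M \<rho> f f' a" and g: "log_jacobian M \<rho> g g' b"
  shows "log_jacobian M \<rho> (\<lambda>x. f (g x)) (\<lambda>x. g' (f' x)) (\<lambda>x. a (g x) + b x)"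
proof -
  note [measurable] = log_jacobianD(1-3)[OF f] log_jacobianD(1-3)[OF g]
  have "distr M M (\<lambda>x. g' (f' x)) = density M (\<lambda>x. ennreal (\<rho> powi (a (g x) + b x)))"
  proof (rule measure_eqI)
    fix A assume "A \<in> sets (distr M M (\<lambda>x. g' (f' x)))"
    then have [measurable]: "A \<in> sets M" by simp
    have "emeasure (distr M M (\<lambda>x. g' (f' x))) A = emeasure (distr M M f') (g' -` A \<inter> space M)"
      using measurable_space[OF log_jacobianD(2)[OF f]]
      by (auto simp: emeasure_distr intro!: arg_cong[where f = "emeasure M"])
    also have "\<dots> = (\<integral>\<^sup>+x. ennreal (\<rho> powi a (g (g' x))) * indicator A (g' x) \<partial>M)"
      unfolding log_jacobianD(6)[OF f]
      by (subst emeasure_density)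
        (auto intro!: nn_integral_cong simp: log_jacobianD(5)[OF g] split: split_indicator)
    also have "\<dots> = (\<integral>\<^sup>+x. ennreal (\<rho> powi a (g x)) * indicator A x \<partial>distr M M g')"
      by (subst nn_integral_distr) auto
    also have "\<dots> = emeasure (density M (\<lambda>x. ennreal (\<rho> powi (a (g x) + b x)))) A"
      unfolding log_jacobianD(6)[OF g] using \<open>0 < \<rho>\<close>
      by (auto intro!: nn_integral_cong
          simp: nn_integral_density emeasure_density power_int_add ennreal_mult mult_ac)
    finally show "emeasure (distr M M (\<lambda>x. g' (f' x))) A
      = emeasure (density M (\<lambda>x. ennreal (\<rho> powi (a (g x) + b x)))) A" .
  qed simp
  then show ?thesis
    using measurable_space[OF log_jacobianD(1)[OF g]] measurable_space[OF log_jacobianD(2)[OF f]]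
    by (simp add: log_jacobian_def log_jacobianD(4,5)[OF f] log_jacobianD(4,5)[OF g])
qed

lemma log_jacobian_inverse:
  assumes "0 < \<rho>" and f: "log_jacobian M \<rho> f g c"
  shows "log_jacobian M \<rho> g f (\<lambda>x. - c (g x))"
proof -
  note [measurable] = log_jacobianD(1-3)[OF f]
  have "distr M M f = density M (\<lambda>x. ennreal (\<rho> powi (- c (g x))))"
  proof (rule measure_eqI)
    fix A assume "A \<in> sets (distr M M f)"
    then have [measurable]: "A \<in> sets M" by simp
    have "emeasure (density M (\<lambda>x. ennreal (\<rho> powi (- c (g x))))) A
        = (\<integral>\<^sup>+x. ennreal (\<rho> powi (- c (g x))) * indicator A (f (g x)) \<partial>M)"
      by (subst emeasure_density)
        (auto intro!: nn_integral_cong simp: log_jacobianD(5)[OF f])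
    also have "\<dots> = (\<integral>\<^sup>+x. ennreal (\<rho> powi (- c x)) * indicator A (f x) \<partial>distr M M g)"
      by (subst nn_integral_distr) auto
    also have "\<dots> = (\<integral>\<^sup>+x. ennreal (\<rho> powi c x) * (ennreal (\<rho> powi (- c x)) * indicator A (f x)) \<partial>M)"
      unfolding log_jacobianD(6)[OF f] by (subst nn_integral_density) auto
    also have "\<dots> = (\<integral>\<^sup>+x. indicator (f -` A \<inter> space M) x \<partial>M)"
      using \<open>0 < \<rho>\<close>
      by (intro nn_integral_cong)
        (auto simp: mult.assoc[symmetric] ennreal_mult[symmetric] power_int_minus split: split_indicator)
    also have "\<dots> = emeasure (distr M M f) A"
      by (subst nn_integral_indicator) (auto simp: emeasure_distr)
    finally show "emeasure (distr M M f) A = emeasure (density M (\<lambda>x. ennreal (\<rho> powi (- c (g x))))) A"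
      by simp
  qed simp
  then show ?thesis
    by (simp add: log_jacobian_def log_jacobianD(4,5)[OF f])
qed

text \<open>
  Because the Jacobian exists in both directions, \<open>f\<close> and its inverse pull null sets back to null
  sets; this is the only form in which non-singularity is used below.
\<close>

lemma log_jacobian_AE:
  assumes "0 < \<rho>" and f: "log_jacobian M \<rho> f g c" and P: "AE x in M. P x"
  shows "AE x in M. P (g x)" "AE x in M. P (f x)"
proof -
  have *: "AE x in M. P (g' x)" if f': "log_jacobian M \<rho> f' g' c'" for f' g' c'
  proof (rule AE_distrD[OF log_jacobianD(2)[OF f']])
    note [measurable] = log_jacobianD(1-3)[OF f']
    show "AE x in distr M M g'. P x"
      unfolding log_jacobianD(6)[OF f'] using P by (subst AE_density) auto
  qed
  show "AE x in M. P (g x)" by (rule *[OF f])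
  show "AE x in M. P (f x)" by (rule *[OF log_jacobian_inverse[OF assms(1,2)]])
qed

section \<open>Ergodicity and the Maharam measure in terms of almost everywhere statements\<close>

text \<open>
  Invariance of \<open>E\<close> is stated through the image \<open>f E\<close>, that is, through the inverse of \<open>f\<close>;
  pulling it back along \<open>f\<close> turns it into a statement about \<open>f x\<close>, which passes to iterates more easily.
\<close>

lemma ergodic_iff_AE_invariant:
  assumes f: "f \<in> M \<rightarrow>\<^sub>M M" and g: "g \<in> M \<rightarrow>\<^sub>M M"
    and gf: "\<And>x. x \<in> space M \<Longrightarrow> g (f x) = x" and fg: "\<And>x. x \<in> space M \<Longrightarrow> f (g x) = x"
    and AE_f: "\<And>P. AE x in M. P x \<Longrightarrow> AE x in M. P (f x)"
    and AE_g: "\<And>P. AE x in M. P x \<Longrightarrow> AE x in M. P (g x)"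
  shows "ergodic M f \<longleftrightarrow>
    (\<forall>E\<in>sets M. (AE x in M. f x \<in> E \<longleftrightarrow> x \<in> E) \<longrightarrow> (AE x in M. x \<notin> E) \<or> (AE x in M. x \<in> E))"
proof -
  have "((f ` E - E) \<union> (E - f ` E) \<in> null_sets M) \<longleftrightarrow> (AE x in M. f x \<in> E \<longleftrightarrow> x \<in> E)"
    and "E \<in> null_sets M \<longleftrightarrow> (AE x in M. x \<notin> E)"
    and "space M - E \<in> null_sets M \<longleftrightarrow> (AE x in M. x \<in> E)"
    if E: "E \<in> sets M" for E
  proof -
    have image: "f ` E = g -` E \<inter> space M"
    proof (intro equalityI subsetI)
      fix y assume "y \<in> f ` E"
      then show "y \<in> g -` E \<inter> space M"
        using sets.sets_into_space[OF E] measurable_space[OF f] gf by auto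
    next
      fix y assume "y \<in> g -` E \<inter> space M"
      then show "y \<in> f ` E" using fg by (auto intro!: image_eqI[of y f "g y"])
    qed
    have [measurable]: "f ` E \<in> sets M" unfolding image using g E by measurable
    have "((f ` E - E) \<union> (E - f ` E) \<in> null_sets M)
        \<longleftrightarrow> (AE x in M. x \<notin> (f ` E - E) \<union> (E - f ` E))"
      using E by (intro AE_iff_null_sets) auto
    also have "\<dots> \<longleftrightarrow> (AE x in M. g x \<in> E \<longleftrightarrow> x \<in> E)"
      by (intro AE_cong) (auto simp: image)
    also have "\<dots> \<longleftrightarrow> (AE x in M. f x \<in> E \<longleftrightarrow> x \<in> E)"
    proof
      assume "AE x in M. g x \<in> E \<longleftrightarrow> x \<in> E"
      from AE_f[OF this] show "AE x in M. f x \<in> E \<longleftrightarrow> x \<in> E"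
        by (rule AE_mp) (auto simp: gf)
    next
      assume "AE x in M. f x \<in> E \<longleftrightarrow> x \<in> E"
      from AE_g[OF this] show "AE x in M. g x \<in> E \<longleftrightarrow> x \<in> E"
        by (rule AE_mp) (auto simp: fg)
    qed
    finally show "((f ` E - E) \<union> (E - f ` E) \<in> null_sets M) \<longleftrightarrow> (AE x in M. f x \<in> E \<longleftrightarrow> x \<in> E)" .
    show "E \<in> null_sets M \<longleftrightarrow> (AE x in M. x \<notin> E)"
      using E by (rule AE_iff_null_sets)
    have "space M - E \<in> null_sets M \<longleftrightarrow> (AE x in M. x \<notin> space M - E)"
      using E by (intro AE_iff_null_sets) auto
    also have "\<dots> \<longleftrightarrow> (AE x in M. x \<in> E)"
      by (intro AE_cong) auto
    finally show "space M - E \<in> null_sets M \<longleftrightarrow> (AE x in M. x \<in> E)" .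
  qed
  then show ?thesis by (simp add: ergodic_def)
qed

text \<open>
  The weights of the slices are positive and there are only countably many slices, so the Maharam measure
  has the null sets of a product measure.
\<close>

lemma AE_maharam_measure_iff:
  assumes "0 < \<rho>"
  shows "(AE z in maharam_measure M \<rho>. P z) \<longleftrightarrow> (\<forall>n. AE x in M. P (x, n))"
proof -
  have null: "E \<in> null_sets (maharam_measure M \<rho>) \<longleftrightarrow> (\<forall>n. (\<lambda>x. (x, n)) -` E \<in> null_sets M)"
    if E: "E \<in> sets (maharam_measure M \<rho>)" for E
  proof -
    have E': "E \<in> sets (M \<Otimes>\<^sub>M count_space UNIV)" using E by simp
    show ?thesis
      using E \<open>0 < \<rho>\<close>
      by (simp add: null_sets_def emeasure_maharam_measure[OF E'] maharam_slice[OF E']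
          nn_integral_0_iff_AE AE_count_space)
  qed
  show ?thesis
  proof
    assume "AE z in maharam_measure M \<rho>. P z"
    then obtain N where N: "N \<in> null_sets (maharam_measure M \<rho>)"
      and sub: "{z \<in> space (maharam_measure M \<rho>). \<not> P z} \<subseteq> N"
      by (auto simp: eventually_ae_filter)
    show "\<forall>n. AE x in M. P (x, n)"
    proof
      fix n
      have "(\<lambda>x. (x, n)) -` N \<in> null_sets M" using N null by blast
      then show "AE x in M. P (x, n)" by (rule AE_I') (use sub in auto)
    qed
  next
    assume "\<forall>n. AE x in M. P (x, n)"
    then have "\<forall>n. \<exists>N\<in>null_sets M. {x \<in> space M. \<not> P (x, n)} \<subseteq> N"
      by (simp add: eventually_ae_filter)
    then obtain N where N: "\<And>n. N n \<in> null_sets M" "\<And>n. {x \<in> space M. \<not> P (x, n)} \<subseteq> N n"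
      by metis
    let ?N = "\<Union>n. N n \<times> {n}"
    have "N n \<times> {n} \<in> sets (M \<Otimes>\<^sub>M count_space UNIV)" for n
      using N(1) by (intro pair_measureI) auto
    then have "?N \<in> sets (M \<Otimes>\<^sub>M count_space UNIV)" by (intro sets.countable_UN') auto
    moreover have "(\<lambda>x. (x, n)) -` ?N = N n" for n by auto
    ultimately have "?N \<in> null_sets (maharam_measure M \<rho>)" using N(1) by (subst null) auto
    then show "AE z in maharam_measure M \<rho>. P z" by (rule AE_I') (use N(2) in auto)
  qed
qed

lemma sets_slice [measurable]:
  assumes "A \<in> sets (maharam_measure M \<rho>)"
  shows "{x \<in> space M. (x, n) \<in> A} \<in> sets M"
proof -
  have "(\<lambda>x. (x, n)) -` A \<in> sets M"
    using assms by (intro maharam_slice) simp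
  moreover have "{x \<in> space M. (x, n) \<in> A} = (\<lambda>x. (x, n)) -` A \<inter> space M" by auto
  ultimately show ?thesis by auto
qed

definition skew_product :: "('a \<Rightarrow> 'a) \<Rightarrow> ('a \<Rightarrow> int) \<Rightarrow> 'a \<times> int \<Rightarrow> 'a \<times> int" where
  "skew_product f c = (\<lambda>(x, n). (f x, n + c x))"

lemma skew_product_apply [simp]: "skew_product f c (x, n) = (f x, n + c x)"
  by (simp add: skew_product_def)

lemma measurable_skew_product [measurable]:
  assumes [measurable]: "f \<in> M \<rightarrow>\<^sub>M M" "c \<in> M \<rightarrow>\<^sub>M count_space UNIV"
  shows "skew_product f c \<in> maharam_measure M \<rho> \<rightarrow>\<^sub>M maharam_measure M \<rho>"
  unfolding skew_product_def split_beta by measurable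

text \<open>
  The shift \<open>n + c x\<close> depends on \<open>x\<close>, so the pull back along \<open>f\<close> is applied to all (countably many)
  slices at once.
\<close>

lemma AE_skew_product:
  assumes "0 < \<rho>" and f: "\<And>Q. AE x in M. Q x \<Longrightarrow> AE x in M. Q (f x)"
    and P: "AE z in maharam_measure M \<rho>. P z"
  shows "AE z in maharam_measure M \<rho>. P (skew_product f c z)"
proof -
  have "AE x in M. \<forall>k. P (x, k)"
    using P \<open>0 < \<rho>\<close> by (simp add: AE_maharam_measure_iff AE_all_countable)
  from f[OF this] have "AE x in M. P (f x, n + c x)" for n
    by (rule AE_mp) auto
  then show ?thesis using \<open>0 < \<rho>\<close> by (simp add: AE_maharam_measure_iff)
qed


section \<open>Iterates and their Birkhoff sums\<close>

locale log_jacobian_cocycle = sigma_finite_measure M for M :: "'a measure" +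
  fixes \<rho> :: real and F :: "'a \<Rightarrow> 'a" and c :: "'a \<Rightarrow> int"
  assumes ratio: "1 < \<rho>"
    and jacobian: "log_jacobian M \<rho> F (the_inv_into (space M) F) c"
begin

abbreviation "F' \<equiv> the_inv_into (space M) F"

abbreviation iter :: "int \<Rightarrow> 'a \<Rightarrow> 'a" where "iter \<equiv> iterate_int M F"

text \<open>
  One of the two sums is always empty; for \<open>n < 0\<close> the sign makes \<open>birkhoff n\<close> the
  logarithm of the Jacobian of a negative iterate, and the recursion
  \<open>c\<^sub>n\<^sub>+\<^sub>1 = c \<circ> F\<^sup>n + c\<^sub>n\<close> holds for all integers \<open>n\<close>.
\<close>

definition birkhoff :: "int \<Rightarrow> 'a \<Rightarrow> int" where
  "birkhoff n x = (\<Sum>i\<in>{0..<n}. c (iter i x)) - (\<Sum>i\<in>{n..<0}. c (iter i x))"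

lemma rho_pos: "0 < \<rho>"
  using ratio by simp

lemmas F_facts = log_jacobianD[OF jacobian]

lemma F_space: "x \<in> space M \<Longrightarrow> F x \<in> space M" "x \<in> space M \<Longrightarrow> F' x \<in> space M"
  using measurable_space[OF F_facts(1)] measurable_space[OF F_facts(2)] by auto

lemma iter_0: "iter 0 x = x"
  by (simp add: iterate_int_def)

lemma iter_space: "x \<in> space M \<Longrightarrow> iter n x \<in> space M"
proof -
  assume x: "x \<in> space M"
  have "(F ^^ k) x \<in> space M" "(F' ^^ k) x \<in> space M" for k
    using x by (induction k) (auto intro: F_space)
  then show ?thesis by (simp add: iterate_int_def)
qed

lemma iter_succ: assumes x: "x \<in> space M" shows "iter (n + 1) x = F (iter n x)"
proof (cases "0 \<le> n")
  case True
  then have "nat (n + 1) = Suc (nat n)" by simp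
  with True show ?thesis by (simp add: iterate_int_def)
next
  case False
  then obtain k where n: "n = - int (Suc k)"
    by (intro that[of "nat (- n - 1)"]) simp
  have "iter (n + 1) x = (F' ^^ k) x" by (simp add: iterate_int_def n)
  moreover have "iter n x = F' ((F' ^^ k) x)"
    by (simp add: iterate_int_def n nat_add_distrib)
  ultimately show ?thesis
    using F_facts(5) iter_space[OF x, of "n + 1"] by simp
qed

lemma iter_pred: "x \<in> space M \<Longrightarrow> iter (n - 1) x = F' (iter n x)"
  using iter_succ[of x "n - 1"] F_facts(4) iter_space by simp

lemma iter_F: assumes x: "x \<in> space M" shows "iter n (F x) = iter (n + 1) x"
proof (induction n rule: int_induct[of _ 0])
  case base
  then show ?case using iter_succ[OF x, of 0] by (simp add: iter_0)
next
  case (step1 i)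
  then show ?case using iter_succ[OF x, of "i + 1"] iter_succ[OF F_space(1)[OF x], of i] by simp
next
  case (step2 i)
  then show ?case using iter_pred[OF x, of "i + 1"] iter_pred[OF F_space(1)[OF x], of i] by simp
qed

lemma iter_F': "x \<in> space M \<Longrightarrow> iter n (F' x) = iter (n - 1) x"
  using iter_F[of "F' x" "n - 1"] F_space F_facts(5) by simp

lemma birkhoff_0: "birkhoff 0 x = 0"
  by (simp add: birkhoff_def)

lemma birkhoff_succ: "birkhoff (n + 1) x = c (iter n x) + birkhoff n x"
proof (cases "0 \<le> n")
  case True
  then have "{0..<n + 1} = insert n {0..<n}" by auto
  with True show ?thesis by (simp add: birkhoff_def)
next
  case False
  then have "{n..<0} = insert n {n + 1..<0}" by auto
  with False show ?thesis by (simp add: birkhoff_def)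
qed

lemma birkhoff_pred: "birkhoff (n - 1) x = - c (iter (n - 1) x) + birkhoff n x"
  using birkhoff_succ[of "n - 1" x] by simp

text \<open>
  The recursion that splits off the first step of the orbit instead of the last one.  Together with
  \<open>iter_F\<close> it says that \<open>G\<^sup>n \<circ> G = G\<^sup>n\<^sup>+\<^sup>1\<close>, which makes unions over orbits invariant.
\<close>

lemma birkhoff_F: assumes x: "x \<in> space M" shows "birkhoff n (F x) + c x = birkhoff (n + 1) x"
proof (induction n rule: int_induct[of _ 0])
  case base
  then show ?case using birkhoff_succ[of 0 x] by (simp add: iter_0 birkhoff_0)
next
  case (step1 i)
  then show ?case using birkhoff_succ[of "i + 1" x] birkhoff_succ[of i "F x"] iter_F[OF x, of i] by simp
next
  case (step2 i)
  then show ?case using birkhoff_pred[of "i + 1" x] birkhoff_pred[of i "F x"] iter_F[OF x, of "i - 1"]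
    by simp
qed

lemma log_jacobian_iter: "log_jacobian M \<rho> (iter n) (iter (- n)) (birkhoff n)"
proof (induction n rule: int_induct[of _ 0])
  case base
  have "log_jacobian M \<rho> (iter 0) (iter (- 0)) (birkhoff 0) = log_jacobian M \<rho> (\<lambda>x. x) (\<lambda>x. x) (\<lambda>x. 0)"
    by (rule log_jacobian_cong) (simp_all add: iter_0 birkhoff_0)
  then show ?case using log_jacobian_id by simp
next
  case (step1 i)
  have "log_jacobian M \<rho> (iter (i + 1)) (iter (- (i + 1))) (birkhoff (i + 1)) =
    log_jacobian M \<rho> (\<lambda>x. F (iter i x)) (\<lambda>x. iter (- i) (F' x)) (\<lambda>x. c (iter i x) + birkhoff i x)"
    by (rule log_jacobian_cong) (simp_all add: iter_succ iter_F' birkhoff_succ)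
  then show ?case using log_jacobian_comp[OF rho_pos jacobian step1(2)] by simp
next
  case (step2 i)
  have "log_jacobian M \<rho> (iter (i - 1)) (iter (- (i - 1))) (birkhoff (i - 1)) =
    log_jacobian M \<rho> (\<lambda>x. F' (iter i x)) (\<lambda>x. iter (- i) (F x)) (\<lambda>x. - c (F' (iter i x)) + birkhoff i x)"
    by (rule log_jacobian_cong) (simp_all add: iter_pred iter_F birkhoff_pred add.commute)
  then show ?case
    using log_jacobian_comp[OF rho_pos log_jacobian_inverse[OF rho_pos jacobian] step2(2)] by simp
qed

lemmas iter_facts = log_jacobianD[OF log_jacobian_iter]

lemmas iter_measurable [measurable] = iter_facts(1,3)

lemma AE_iterate_density: "AE x in M. iterate_density M F n x = \<rho> powi birkhoff n x"
proof -
  have "AE x in M. ennreal (\<rho> powi birkhoff n x) = RN_deriv M (distr M M (iter (- n))) x"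
    by (rule RN_deriv_unique) (simp_all add: iter_facts(6))
  then show ?thesis
    by (rule AE_mp)
      (auto simp: iterate_density_def rho_pos less_imp_le zero_le_power_int dest!: sym)
qed

lemmas F_measurable [measurable] = F_facts(1,2,3)

abbreviation "maharam \<equiv> maharam_measure M \<rho>"

abbreviation "G \<equiv> skew_product F c"

lemma AE_iter: "AE x in M. P x \<Longrightarrow> AE x in M. P (iter n x)"
  by (rule log_jacobian_AE(2)[OF rho_pos log_jacobian_iter])

lemma ergodic_F_iff:
  "ergodic M F \<longleftrightarrow>
    (\<forall>E\<in>sets M. (AE x in M. F x \<in> E \<longleftrightarrow> x \<in> E) \<longrightarrow> (AE x in M. x \<notin> E) \<or> (AE x in M. x \<in> E))"
  by (rule ergodic_iff_AE_invariant[of F M F'])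
    (simp_all add: F_facts log_jacobian_AE[OF rho_pos jacobian])

lemma ergodic_G_iff:
  "ergodic maharam G \<longleftrightarrow>
    (\<forall>A\<in>sets maharam. (AE z in maharam. G z \<in> A \<longleftrightarrow> z \<in> A) \<longrightarrow>
      (AE z in maharam. z \<notin> A) \<or> (AE z in maharam. z \<in> A))"
proof (rule ergodic_iff_AE_invariant[of G _ "skew_product F' (\<lambda>x. - c (F' x))"])
  show "AE z in maharam. P (G z)" if "AE z in maharam. P z" for P
    using rho_pos log_jacobian_AE(2)[OF rho_pos jacobian] that by (rule AE_skew_product)
  show "AE z in maharam. P (skew_product F' (\<lambda>x. - c (F' x)) z)" if "AE z in maharam. P z" for P
    using rho_pos log_jacobian_AE(1)[OF rho_pos jacobian] that by (rule AE_skew_product)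
qed (auto simp: F_facts)

text \<open>
  Consecutive iterates of the skew product differ by one application of \<open>G\<close>, so the step in either
  direction is the hypothesis pulled back along an iterate.
\<close>

lemma AE_invariant_iter:
  assumes "AE z in maharam. G z \<in> A \<longleftrightarrow> z \<in> A"
  shows "AE z in maharam. skew_product (iter n) (birkhoff n) z \<in> A \<longleftrightarrow> z \<in> A"
proof -
  have step: "AE z in maharam. skew_product (iter (m + 1)) (birkhoff (m + 1)) z \<in> A \<longleftrightarrow>
      skew_product (iter m) (birkhoff m) z \<in> A" for m
  proof -
    have "AE z in maharam. G (skew_product (iter m) (birkhoff m) z) \<in> A
        \<longleftrightarrow> skew_product (iter m) (birkhoff m) z \<in> A"
      using rho_pos AE_iter assms by (rule AE_skew_product)
    then show ?thesis
      by (rule AE_mp) (rule AE_I2, auto simp: iter_succ birkhoff_succ add.assoc add.commute[of "birkhoff _ _"])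
  qed
  show ?thesis
  proof (induction n rule: int_induct[of _ 0])
    case base
    show ?case by (auto simp: skew_product_def iter_0 birkhoff_0)
  next
    case (step1 i)
    from step1(2) step[of i] show ?case by eventually_elim auto
  next
    case (step2 i)
    from step2(2) step[of "i - 1"] show ?case by eventually_elim simp
  qed
qed

section \<open>Essential values and the ratio set\<close>

text \<open>
  This is the notion of an essential value of a cocycle (in the sense of Schmidt's theory of
  cocycles), for the integer-valued cocycle \<open>birkhoff\<close>; as \<open>\<int>\<close> is discrete, the exact value \<open>k\<close> replaces its
  neighbourhoods.
\<close>

definition essential_value :: "int \<Rightarrow> bool" where
  "essential_value k \<longleftrightarrow> (\<forall>E\<in>sets M. \<not> (AE x in M. x \<notin> E) \<longrightarrow>
     (\<exists>n. \<not> (AE x in M. x \<in> E \<longrightarrow> iter n x \<in> E \<longrightarrow> birkhoff n x \<noteq> k)))"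

lemma emeasure_pos_iff_not_AE: "A \<in> sets M \<Longrightarrow> emeasure M A > 0 \<longleftrightarrow> \<not> (AE x in M. x \<notin> A)"
  by (simp add: AE_iff_null_sets[symmetric] null_sets_def zero_less_iff_neq_zero)

text \<open>
  Essential values give elements of the ratio set, and the ratio set is closed under limits.  The limit
  form covers both the powers of \<open>\<rho>\<close> and their accumulation point \<open>0\<close>.
\<close>

lemma ratio_set_limit:
  assumes "0 \<le> r" and lim: "\<And>\<epsilon>. 0 < \<epsilon> \<Longrightarrow> \<exists>k. essential_value k \<and> \<bar>\<rho> powi k - r\<bar> < \<epsilon>"
  shows "r \<in> ratio_set M F"
  unfolding ratio_set_def
proof (intro CollectI conjI ballI impI allI)
  fix E \<epsilon> assume E[measurable]: "E \<in> sets M" and pos: "emeasure M E > 0" and \<epsilon>: "(0::real) < \<epsilon>"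
  from lim[OF \<epsilon>] obtain k where k: "essential_value k" "\<bar>\<rho> powi k - r\<bar> < \<epsilon>" by blast
  then obtain n where n: "\<not> (AE x in M. x \<in> E \<longrightarrow> iter n x \<in> E \<longrightarrow> birkhoff n x \<noteq> k)"
    using pos E by (auto simp: essential_value_def emeasure_pos_iff_not_AE)
  from AE_iterate_density[of n] obtain N where N: "N \<in> null_sets M"
    and sub: "{x \<in> space M. iterate_density M F n x \<noteq> \<rho> powi birkhoff n x} \<subseteq> N"
    by (auto simp: eventually_ae_filter)
  \<comment> \<open>the ratio set asks for the density at every point of the subset, hence the removal of \<open>N\<close>\<close>
  define E' where "E' = {x \<in> space M. x \<in> E \<and> iter n x \<in> E \<and> birkhoff n x = k} - N"
  have [measurable]: "N \<in> sets M" using N by auto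
  have E': "E' \<in> sets M" unfolding E'_def by measurable
  have "\<not> (AE x in M. x \<notin> E')"
  proof
    assume "AE x in M. x \<notin> E'"
    with AE_not_in[OF N] have "AE x in M. x \<in> E \<longrightarrow> iter n x \<in> E \<longrightarrow> birkhoff n x \<noteq> k"
      using AE_space by eventually_elim (auto simp: E'_def)
    with n show False ..
  qed
  then show "\<exists>E'\<in>sets M. \<exists>n. E' \<subseteq> E \<and> 0 < emeasure M E' \<and>
      (\<forall>x\<in>E'. iter n x \<in> E \<and> \<bar>iterate_density M F n x - r\<bar> < \<epsilon>)"
    using E' k(2) sub
    by (intro bexI[of _ E'] exI[of _ n]) (auto simp: emeasure_pos_iff_not_AE E'_def)
qed fact

text \<open>
  The powers of \<open>\<rho>\<close> accumulate only at \<open>0\<close>.  Approximation within \<open>\<epsilon>\<close> to \<open>r > 0\<close> by a power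
  therefore becomes equality, whether or not \<open>r\<close> itself is a power.
\<close>

lemma powi_isolated:
  assumes "0 < r"
  shows "\<exists>\<epsilon>>0. \<forall>j. \<bar>\<rho> powi j - r\<bar> < \<epsilon> \<longrightarrow> \<rho> powi j = r"
proof -
  define k where "k = \<lfloor>log \<rho> r\<rfloor>"
  have "\<rho> powr real_of_int k \<le> r" "r < \<rho> powr real_of_int (k + 1)"
    using ratio assms real_of_int_floor_add_one_gt[of "log \<rho> r"] unfolding k_def
    by (simp_all add: powr_le_iff less_powr_iff)
  then have k: "\<rho> powi k \<le> r" "r < \<rho> powi (k + 1)"
    using powr_real_of_int'[of \<rho> k] powr_real_of_int'[of \<rho> "k + 1"] rho_pos by simp_all
  have less: "\<rho> powi (k - 1) < \<rho> powi k"
    using ratio by (intro power_int_strict_increasing) auto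
  \<comment> \<open>at most the distance of \<open>r\<close> to any other power; the \<open>1\<close> replaces the distance \<open>0\<close> if \<open>r = \<rho>\<^sup>k\<close>\<close>
  define \<epsilon> where "\<epsilon> = min (\<rho> powi (k + 1) - r)
    (min (r - \<rho> powi (k - 1)) (if \<rho> powi k = r then 1 else r - \<rho> powi k))"
  have "\<rho> powi j = r" if j: "\<bar>\<rho> powi j - r\<bar> < \<epsilon>" for j
  proof -
    consider "j \<le> k - 1" | "j = k" | "k + 1 \<le> j" by linarith
    then show ?thesis
    proof cases
      case 1
      then have "\<rho> powi j \<le> \<rho> powi (k - 1)" using ratio by (intro power_int_increasing) auto
      moreover have "\<rho> powi (k - 1) < r" using less k(1) by simp
      ultimately show ?thesis using j by (simp add: \<epsilon>_def)
    next
      case 2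
      then show ?thesis using j by (auto simp: \<epsilon>_def split: if_splits)
    next
      case 3
      then have "\<rho> powi (k + 1) \<le> \<rho> powi j" using ratio by (intro power_int_increasing) auto
      then show ?thesis using j k(2) by (simp add: \<epsilon>_def)
    qed
  qed
  moreover have "0 < \<epsilon>" using k less by (auto simp: \<epsilon>_def)
  ultimately show ?thesis by blast
qed

lemma powi_eq_iff: "\<rho> powi i = \<rho> powi j \<longleftrightarrow> i = j"
  using power_int_strict_increasing[of i j \<rho>] power_int_strict_increasing[of j i \<rho>] ratio
  by (cases i j rule: linorder_cases) auto

lemma ratio_set_return:
  assumes r: "r \<in> ratio_set M F" "0 < r" and E: "E \<in> sets M" "\<not> (AE x in M. x \<notin> E)"
  shows "\<exists>n. \<not> (AE x in M. x \<in> E \<longrightarrow> iter n x \<in> E \<longrightarrow> \<rho> powi birkhoff n x \<noteq> r)"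
proof -
  obtain \<epsilon> where \<epsilon>: "0 < \<epsilon>" "\<And>j. \<bar>\<rho> powi j - r\<bar> < \<epsilon> \<Longrightarrow> \<rho> powi j = r"
    using powi_isolated[OF r(2)] by blast
  have "emeasure M E > 0" using E by (simp add: emeasure_pos_iff_not_AE)
  with r(1) E(1) \<epsilon>(1) have "\<exists>E'\<in>sets M. \<exists>n. E' \<subseteq> E \<and> 0 < emeasure M E' \<and>
      (\<forall>x\<in>E'. iter n x \<in> E \<and> \<bar>iterate_density M F n x - r\<bar> < \<epsilon>)"
    by (simp add: ratio_set_def)
  then obtain E' n where E': "E' \<in> sets M" "E' \<subseteq> E" "emeasure M E' > 0"
    "\<And>x. x \<in> E' \<Longrightarrow> iter n x \<in> E \<and> \<bar>iterate_density M F n x - r\<bar> < \<epsilon>"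
    by blast
  have "\<not> (AE x in M. x \<in> E \<longrightarrow> iter n x \<in> E \<longrightarrow> \<rho> powi birkhoff n x \<noteq> r)"
  proof
    assume "AE x in M. x \<in> E \<longrightarrow> iter n x \<in> E \<longrightarrow> \<rho> powi birkhoff n x \<noteq> r"
    with AE_iterate_density[of n] have "AE x in M. x \<notin> E'"
      by eventually_elim (use E'(2,4) \<epsilon>(2) in force)
    with E'(1,3) show False by (simp add: emeasure_pos_iff_not_AE)
  qed
  then show ?thesis ..
qed

text \<open>
  On a null space every nonnegative number is in the ratio set; otherwise the whole space is a set of positive
  measure, and a return to it shows that \<open>r\<close> is the value of a Jacobian.
\<close>

lemma ratio_set_pos_iff:
  assumes nonnull: "\<not> (AE x in M. False)" and "0 < r"
  shows "r \<in> ratio_set M F \<longleftrightarrow> (\<exists>k. r = \<rho> powi k \<and> essential_value k)"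
proof
  assume r: "r \<in> ratio_set M F"
  have "\<not> (AE x in M. x \<notin> space M)"
  proof
    assume "AE x in M. x \<notin> space M"
    then have "AE x in M. False" using AE_space by eventually_elim simp
    with nonnull show False ..
  qed
  from ratio_set_return[OF r assms(2) sets.top this] have "\<exists>k. r = \<rho> powi k"
    by (rule contrapos_pp) auto
  then obtain k where k: "r = \<rho> powi k" ..
  have "essential_value k"
    unfolding essential_value_def
    using ratio_set_return[OF r assms(2)] by (simp add: k powi_eq_iff)
  with k show "\<exists>k. r = \<rho> powi k \<and> essential_value k" by blast
next
  assume "\<exists>k. r = \<rho> powi k \<and> essential_value k"
  then show "r \<in> ratio_set M F"
    using \<open>0 < r\<close> by (intro ratio_set_limit) force+
qed

lemma krieger_type_III_iff:
  assumes nonnull: "\<not> (AE x in M. False)"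
  shows "krieger_type_III M F (1 / \<rho>) \<longleftrightarrow> ergodic M F \<and> (\<forall>k. essential_value k)"
proof -
  have powers: "{(1 / \<rho>) powi n | n. True} = range (\<lambda>k. \<rho> powi k)"
  proof -
    have "(1 / \<rho>) powi n = \<rho> powi (- n)" for n
      by (simp add: power_int_minus power_int_divide_distrib field_simps)
    then have "{(1 / \<rho>) powi n | n. True} = (\<lambda>k. \<rho> powi k) ` range uminus"
      unfolding image_image by (simp add: full_SetCompr_eq)
    then show ?thesis by (simp only: surj_uminus)
  qed
  have "ratio_set M F = {0} \<union> {(1 / \<rho>) powi n | n. True} \<longleftrightarrow> (\<forall>k. essential_value k)"
    unfolding powers
  proof
    assume eq: "ratio_set M F = {0} \<union> range (\<lambda>k. \<rho> powi k)"
    show "\<forall>k. essential_value k"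
    proof
      fix k
      have "\<rho> powi k \<in> ratio_set M F" unfolding eq by simp
      then show "essential_value k"
        using ratio_set_pos_iff[OF nonnull, of "\<rho> powi k"] rho_pos
        by (auto simp: powi_eq_iff)
    qed
  next
    assume ess: "\<forall>k. essential_value k"
    have "0 \<in> ratio_set M F"
    proof (rule ratio_set_limit)
      fix \<epsilon> :: real assume "0 < \<epsilon>"
      moreover have "inverse \<rho> < 1" using ratio by (simp add: inverse_eq_divide)
      ultimately obtain n where "inverse \<rho> ^ n < \<epsilon>" using real_arch_pow_inv by blast
      then show "\<exists>k. essential_value k \<and> \<bar>\<rho> powi k - 0\<bar> < \<epsilon>"
        using ess rho_pos
        by (intro exI[of _ "- int n"]) (simp add: power_int_minus power_inverse)
    qed simp
    moreover have "r \<in> ratio_set M F \<longleftrightarrow> r \<in> range (\<lambda>k. \<rho> powi k)" if "0 < r" for r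
      using ratio_set_pos_iff[OF nonnull that] ess by auto
    moreover have "0 \<le> r" if "r \<in> ratio_set M F" for r
      using that by (simp add: ratio_set_def)
    moreover have "0 < r" if "r \<in> range (\<lambda>k. \<rho> powi k)" for r using that rho_pos by auto
    ultimately show "ratio_set M F = {0} \<union> range (\<lambda>k. \<rho> powi k)"
      by (intro set_eqI) (metis Un_iff insert_iff empty_iff order_le_less)
  qed
  then show ?thesis using ratio by (auto simp: krieger_type_III_def)
qed

section \<open>Ergodicity of the skew product\<close>

text \<open>
  The set \<open>U\<close> of all points whose \<open>G\<close>-orbit meets \<open>E \<times> {k}\<close> is invariant, so it is null or
  conull.  It contains \<open>E \<times> {k}\<close>, so it is conull; on the slice \<open>0\<close> this says that almost every point
  of \<open>E\<close> has an iterate in \<open>E\<close> at which the Birkhoff sum is \<open>k\<close>.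
\<close>

lemma essential_value_if_ergodic:
  assumes erg: "ergodic maharam G"
  shows "essential_value k"
  unfolding essential_value_def
proof (intro ballI impI)
  fix E assume E[measurable]: "E \<in> sets M" and pos: "\<not> (AE x in M. x \<notin> E)"
  define U where "U = {z \<in> space M \<times> UNIV. \<exists>n. skew_product (iter n) (birkhoff n) z \<in> E \<times> {k}}"
  have U_iff: "(x, m) \<in> U \<longleftrightarrow> (\<exists>n. iter n x \<in> E \<and> m + birkhoff n x = k)" if "x \<in> space M" for x m
    using that by (auto simp: U_def)
  have Ek: "E \<times> {k} \<in> sets maharam" by simp
  have "(\<Union>n. skew_product (iter n) (birkhoff n) -` (E \<times> {k}) \<inter> space maharam) \<in> sets maharam"
    using measurable_sets[OF measurable_skew_product[OF iter_measurable] Ek]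
    by (intro sets.countable_UN') auto
  also have "(\<Union>n. skew_product (iter n) (birkhoff n) -` (E \<times> {k}) \<inter> space maharam) = U"
    by (auto simp: U_def)
  finally have U: "U \<in> sets maharam" .
  have "AE z in maharam. G z \<in> U \<longleftrightarrow> z \<in> U"
  proof (rule AE_I2, clarsimp simp: U_iff F_space)
    fix x m assume x: "x \<in> space M"
    have "(\<exists>n. iter n (F x) \<in> E \<and> m + c x + birkhoff n (F x) = k)
        \<longleftrightarrow> (\<exists>n. iter (n + 1) x \<in> E \<and> m + birkhoff (n + 1) x = k)"
      using x by (simp add: iter_F birkhoff_F[symmetric] ac_simps)
    also have "\<dots> \<longleftrightarrow> (\<exists>n. iter n x \<in> E \<and> m + birkhoff n x = k)"
      by (rule iffI; elim exE) (blast, rule_tac x = "n - 1" in exI, simp)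
    finally show "(\<exists>n. iter n (F x) \<in> E \<and> m + c x + birkhoff n (F x) = k)
        \<longleftrightarrow> (\<exists>n. iter n x \<in> E \<and> m + birkhoff n x = k)" .
  qed
  then have "(AE z in maharam. z \<notin> U) \<or> (AE z in maharam. z \<in> U)"
    using erg U unfolding ergodic_G_iff by blast
  then show "\<exists>n. \<not> (AE x in M. x \<in> E \<longrightarrow> iter n x \<in> E \<longrightarrow> birkhoff n x \<noteq> k)"
  proof
    assume "AE z in maharam. z \<notin> U"
    then have "AE x in M. (x, k) \<notin> U" by (simp add: AE_maharam_measure_iff rho_pos)
    then have "AE x in M. x \<notin> E"
      using AE_space
    proof eventually_elim
      case (elim x)
      then have "\<not> (iter 0 x \<in> E \<and> k + birkhoff 0 x = k)" unfolding U_iff[OF elim(2)] by blast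
      then show ?case by (simp add: iter_0 birkhoff_0)
    qed
    with pos show ?thesis ..
  next
    assume "AE z in maharam. z \<in> U"
    then have U0: "AE x in M. (x, 0) \<in> U" by (simp add: AE_maharam_measure_iff rho_pos)
    show ?thesis
    proof (rule ccontr)
      assume "\<not> ?thesis"
      then have "AE x in M. \<forall>n. x \<in> E \<longrightarrow> iter n x \<in> E \<longrightarrow> birkhoff n x \<noteq> k"
        unfolding AE_all_countable by blast
      with U0 have "AE x in M. x \<notin> E"
        using AE_space by eventually_elim (auto simp: U_iff)
      with pos show False ..
    qed
  qed
qed

lemma ergodic_base_if_ergodic:
  assumes erg: "ergodic maharam G"
  shows "ergodic M F"
  unfolding ergodic_F_iff
proof (intro ballI impI)
  fix E assume E: "E \<in> sets M" and inv: "AE x in M. F x \<in> E \<longleftrightarrow> x \<in> E"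
  have "E \<times> UNIV \<in> sets maharam" using E by simp
  moreover have "AE z in maharam. G z \<in> E \<times> UNIV \<longleftrightarrow> z \<in> E \<times> UNIV"
    using inv by (simp add: AE_maharam_measure_iff rho_pos)
  ultimately have "(AE z in maharam. z \<notin> E \<times> UNIV) \<or> (AE z in maharam. z \<in> E \<times> UNIV)"
    using erg unfolding ergodic_G_iff by blast
  then show "(AE x in M. x \<notin> E) \<or> (AE x in M. x \<in> E)"
    by (simp add: AE_maharam_measure_iff rho_pos)
qed

text \<open>
  An essential value \<open>k\<close> is a period of every invariant set: on the set \<open>E\<close> where \<open>A\<close> violates the
  implication, a return to \<open>E\<close> with Birkhoff sum \<open>k\<close> moves \<open>(x, n) \<in> A\<close> to a point of
  \<open>E \<times> {n + k}\<close>, which is disjoint from \<open>A\<close>.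
\<close>

lemma essential_value_translation:
  assumes k: "essential_value k" and A[measurable]: "A \<in> sets maharam"
    and inv: "AE z in maharam. G z \<in> A \<longleftrightarrow> z \<in> A"
  shows "AE x in M. (x, n) \<in> A \<longrightarrow> (x, n + k) \<in> A"
proof (rule ccontr)
  assume *: "\<not> ?thesis"
  define E where "E = {x \<in> space M. (x, n) \<in> A} - {x \<in> space M. (x, n + k) \<in> A}"
  have "E \<in> sets M" unfolding E_def using A by (intro sets.Diff sets_slice)
  moreover have "\<not> (AE x in M. x \<notin> E)"
  proof
    assume "AE x in M. x \<notin> E"
    then have "AE x in M. (x, n) \<in> A \<longrightarrow> (x, n + k) \<in> A"
      using AE_space by eventually_elim (auto simp: E_def)
    with * show False ..
  qed
  ultimately obtain m where m: "\<not> (AE x in M. x \<in> E \<longrightarrow> iter m x \<in> E \<longrightarrow> birkhoff m x \<noteq> k)"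
    using k unfolding essential_value_def by blast
  have "AE x in M. skew_product (iter m) (birkhoff m) (x, n) \<in> A \<longleftrightarrow> (x, n) \<in> A"
    using AE_invariant_iter[OF inv, of m] rho_pos unfolding AE_maharam_measure_iff[OF rho_pos] by blast
  then have "AE x in M. x \<in> E \<longrightarrow> iter m x \<in> E \<longrightarrow> birkhoff m x \<noteq> k"
    by eventually_elim (auto simp: E_def)
  with m show False ..
qed

theorem ergodic_skew_product_iff:
  "ergodic maharam G \<longleftrightarrow> ergodic M F \<and> (\<forall>k. essential_value k)"
proof
  assume "ergodic maharam G"
  then show "ergodic M F \<and> (\<forall>k. essential_value k)"
    using essential_value_if_ergodic ergodic_base_if_ergodic by blast
next
  assume *: "ergodic M F \<and> (\<forall>k. essential_value k)"
  show "ergodic maharam G"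
    unfolding ergodic_G_iff
  proof (intro ballI impI)
    fix A assume A: "A \<in> sets maharam" and inv: "AE z in maharam. G z \<in> A \<longleftrightarrow> z \<in> A"
    define E where "E = {x \<in> space M. (x, 0 :: int) \<in> A}"
    have E: "E \<in> sets M" unfolding E_def using A by (rule sets_slice)
    have "AE x in M. (x, n) \<in> A \<longleftrightarrow> x \<in> E" for n
    proof -
      have "AE x in M. (x, n) \<in> A \<longrightarrow> (x, n + - n) \<in> A" "AE x in M. (x, 0) \<in> A \<longrightarrow> (x, 0 + n) \<in> A"
        using * A inv by (blast intro: essential_value_translation)+
      then show ?thesis using AE_space by eventually_elim (auto simp: E_def)
    qed
    then have slices: "AE x in M. \<forall>n. (x, n) \<in> A \<longleftrightarrow> x \<in> E" by (simp add: AE_all_countable)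
    have "AE x in M. G (x, 0) \<in> A \<longleftrightarrow> (x, 0) \<in> A"
      using inv unfolding AE_maharam_measure_iff[OF rho_pos] by blast
    with slices log_jacobian_AE(2)[OF rho_pos jacobian slices] have "AE x in M. F x \<in> E \<longleftrightarrow> x \<in> E"
      by eventually_elim auto
    with * E have "(AE x in M. x \<notin> E) \<or> (AE x in M. x \<in> E)"
      unfolding ergodic_F_iff by blast
    then show "(AE z in maharam. z \<notin> A) \<or> (AE z in maharam. z \<in> A)"
    proof
      assume "AE x in M. x \<notin> E"
      with slices have "AE x in M. \<forall>n. (x, n) \<notin> A" by eventually_elim simp
      then show ?thesis by (simp add: AE_maharam_measure_iff rho_pos AE_all_countable)
    next
      assume "AE x in M. x \<in> E"
      with slices have "AE x in M. \<forall>n. (x, n) \<in> A" by eventually_elim simp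
      then show ?thesis by (simp add: AE_maharam_measure_iff rho_pos AE_all_countable)
    qed
  qed
qed

end

section \<open>The Jacobian of a reciprocal transformation\<close>

lemma log_jacobian_bimeasurable_bij:
  assumes f: "bimeasurable_bij M f" and [measurable]: "c \<in> M \<rightarrow>\<^sub>M count_space UNIV"
    and eq: "\<And>A. A \<in> sets M \<Longrightarrow>
      emeasure M (f ` A) = (\<integral>\<^sup>+x. ennreal (\<rho> powi c x) * indicator A x \<partial>M)"
  shows "log_jacobian M \<rho> f (the_inv_into (space M) f) c"
proof -
  let ?g = "the_inv_into (space M) f"
  have bij: "inj_on f (space M)" "f ` space M = space M"
    and f_meas: "f \<in> M \<rightarrow>\<^sub>M M" and img: "\<And>A. A \<in> sets M \<Longrightarrow> f ` A \<in> sets M"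
    using f by (auto simp: bimeasurable_bij_def bij_betw_def)
  have gf: "?g (f x) = x" and fg: "f (?g x) = x" and g_space: "?g x \<in> space M" if "x \<in> space M" for x
    using that bij by (auto simp: the_inv_into_f_f f_the_inv_into_f intro!: the_inv_into_into)
  have vimage: "?g -` A \<inter> space M = f ` A" if "A \<in> sets M" for A
    using sets.sets_into_space[OF that] gf fg measurable_space[OF f_meas]
    by (auto intro!: image_eqI[of _ f])
  have g_meas[measurable]: "?g \<in> M \<rightarrow>\<^sub>M M"
    by (rule measurableI) (auto simp: g_space vimage img)
  have "distr M M ?g = density M (\<lambda>x. ennreal (\<rho> powi c x))"
    by (rule measure_eqI) (auto simp: emeasure_distr vimage eq emeasure_density)
  then show ?thesis
    using f_meas by (auto simp: log_jacobian_def gf fg)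
qed

lemma log_jacobian_measure_preserving:
  assumes "measure_preserving_transformation M T"
  shows "log_jacobian M \<rho> T (the_inv_into (space M) T) (\<lambda>x. 0)"
  using assms
  by (intro log_jacobian_bimeasurable_bij) (auto simp: measure_preserving_transformation_def)

text \<open>
  The definition prescribes the scaling on subsets of \<open>S\<close> only.  Up to a null set \<open>E\<close> is the image of
  \<open>E' = \<Phi>\<^sup>-\<^sup>1 E \<inter> S\<close>, which gives \<open>\<mu> E = \<rho> \<mu> E'\<close>, and \<open>\<Phi> E = \<Phi> (\<Phi> E') = E'\<close> since
  \<open>\<Phi>\<close> is an involution.  The second equation needs care, because \<open>\<Phi>\<close> is an involution only almost everywhere and
  the images of null sets outside \<open>S\<close> are not yet known to be null: the exceptional points are
  traced back to a null subset of \<open>S\<close>, on which the scaling applies.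
\<close>

lemma scaling_involution_contracts:
  assumes "finite_measure M" and \<Phi>: "scaling_involution M \<Phi> S"
    and E: "E \<in> sets M" "E \<inter> S = {}"
  shows "scaling_ratio M \<Phi> S * measure M (\<Phi> ` E) = measure M E"
proof -
  interpret finite_measure M by fact
  have inj: "inj_on \<Phi> (space M)" and meas[measurable]: "\<Phi> \<in> M \<rightarrow>\<^sub>M M"
    and img: "\<And>A. A \<in> sets M \<Longrightarrow> \<Phi> ` A \<in> sets M"
    and S[measurable]: "S \<in> sets M"
    and invol: "AE x in M. \<Phi> (\<Phi> x) = x"
    and cover: "space M - (S \<union> \<Phi> ` S) \<in> null_sets M"
    and scale: "\<And>A. A \<in> sets M \<Longrightarrow> A \<subseteq> S \<Longrightarrow>
      measure M (\<Phi> ` A) = scaling_ratio M \<Phi> S * measure M A"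
    using \<Phi> by (auto simp: scaling_involution_def bimeasurable_bij_def bij_betw_def)
  note [measurable] = E(1)
  note in_space = sets.sets_into_space[OF S] sets.sets_into_space[OF E(1)] measurable_space[OF meas]
  from invol obtain N where N: "N \<in> null_sets M" and sub: "{x \<in> space M. \<Phi> (\<Phi> x) \<noteq> x} \<subseteq> N"
    by (auto simp: eventually_ae_filter)
  have [measurable]: "N \<in> sets M" using N by auto
  have "measure M (\<Phi> ` (N \<inter> S)) = 0"
    using N scale[of "N \<inter> S"] by (simp add: measure_eq_0_null_sets null_set_Int2)
  then have NS: "\<Phi> ` (N \<inter> S) \<in> null_sets M"
    using img[of "N \<inter> S"] by (auto simp: null_sets_def emeasure_eq_measure)
  define E' where "E' = \<Phi> -` E \<inter> space M \<inter> S"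
  have E': "E' \<in> sets M" "E' \<subseteq> S" unfolding E'_def by auto
  have "AE y in M. y \<in> \<Phi> ` E \<longleftrightarrow> y \<in> E'"
    using AE_not_in[OF N] AE_not_in[OF NS] AE_not_in[OF cover] AE_space
  proof eventually_elim
    case (elim y)
    then have y: "\<Phi> (\<Phi> y) = y" and ysp: "\<Phi> y \<in> space M" using sub in_space by auto
    have "y \<in> \<Phi> ` E \<longleftrightarrow> \<Phi> y \<in> E"
    proof
      assume "y \<in> \<Phi> ` E"
      then obtain e where e: "e \<in> E" "y = \<Phi> e" by blast
      then have "\<Phi> (\<Phi> y) = \<Phi> e" using y by simp
      then show "\<Phi> y \<in> E" using inj_onD[OF inj _ ysp] e(1) in_space(2) by auto
    qed (use y in \<open>force intro: image_eqI[of y \<Phi> "\<Phi> y"]\<close>)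
    moreover have "y \<in> S" if "\<Phi> y \<in> E"
    proof (rule ccontr)
      assume "y \<notin> S"
      then obtain s where s: "s \<in> S" "y = \<Phi> s" using elim by blast
      then have "\<Phi> (\<Phi> s) = s" using elim sub in_space by blast
      then show False using that s E(2) by auto
    qed
    ultimately show ?case using elim by (auto simp: E'_def)
  qed
  then have "measure M (\<Phi> ` E) = measure M E'"
    using img[OF E(1)] E' by (intro measure_eq_AE) auto
  also have "scaling_ratio M \<Phi> S * measure M E' = measure M (\<Phi> ` E')"
    using scale[OF E'] by simp
  also have "measure M (\<Phi> ` E') = measure M E"
  proof (rule measure_eq_AE)
    show "AE y in M. y \<in> \<Phi> ` E' \<longleftrightarrow> y \<in> E"
      using AE_not_in[OF cover] AE_space
      by eventually_elim (use E(2) in_space in \<open>auto simp: E'_def\<close>)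
  qed (use E'(1) img in auto)
  finally show ?thesis .
qed

lemma log_jacobian_scaling_involution:
  assumes "finite_measure M" and \<Phi>: "scaling_involution M \<Phi> S"
    and \<rho>: "\<rho> = scaling_ratio M \<Phi> S" "0 < \<rho>"
  shows "log_jacobian M \<rho> \<Phi> (the_inv_into (space M) \<Phi>) (\<lambda>x. if x \<in> S then 1 else - 1)"
proof (rule log_jacobian_bimeasurable_bij)
  interpret finite_measure M by fact
  show bij: "bimeasurable_bij M \<Phi>" using \<Phi> by (simp add: scaling_involution_def)
  have [measurable]: "S \<in> sets M" using \<Phi> by (simp add: scaling_involution_def)
  show "(\<lambda>x. if x \<in> S then 1 else - 1 :: int) \<in> M \<rightarrow>\<^sub>M count_space UNIV" by measurable
  fix A assume A[measurable]: "A \<in> sets M"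
  have img: "\<And>B. B \<in> sets M \<Longrightarrow> \<Phi> ` B \<in> sets M" and inj: "inj_on \<Phi> (space M)"
    using bij by (auto simp: bimeasurable_bij_def bij_betw_def)
  have "\<Phi> ` A = \<Phi> ` (A \<inter> S) \<union> \<Phi> ` (A - S)" by blast
  moreover have "\<Phi> ` (A \<inter> S) \<inter> \<Phi> ` (A - S) = {}"
    using inj_on_image_Int[OF inj, of "A \<inter> S" "A - S"] sets.sets_into_space[OF A] by blast
  ultimately have "measure M (\<Phi> ` A) = measure M (\<Phi> ` (A \<inter> S)) + measure M (\<Phi> ` (A - S))"
    using img[of "A \<inter> S"] img[of "A - S"] by (simp add: finite_measure_Union)
  also have "measure M (\<Phi> ` (A \<inter> S)) = \<rho> * measure M (A \<inter> S)"
    using \<Phi> \<rho>(1) by (simp add: scaling_involution_def)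
  also have "measure M (\<Phi> ` (A - S)) = inverse \<rho> * measure M (A - S)"
    using scaling_involution_contracts[OF assms(1) \<Phi>, of "A - S"] \<rho> by (auto simp: field_simps)
  finally have "emeasure M (\<Phi> ` A)
      = ennreal \<rho> * emeasure M (A \<inter> S) + ennreal (inverse \<rho>) * emeasure M (A - S)"
    using \<rho>(2) by (simp add: emeasure_eq_measure ennreal_mult)
  also have "\<dots> = (\<integral>\<^sup>+x. ennreal \<rho> * indicator (A \<inter> S) x + ennreal (inverse \<rho>) * indicator (A - S) x \<partial>M)"
    by (simp add: nn_integral_add nn_integral_cmult)
  also have "\<dots> = (\<integral>\<^sup>+x. ennreal (\<rho> powi (if x \<in> S then 1 else - 1)) * indicator A x \<partial>M)"
    by (intro nn_integral_cong) (auto simp: power_int_minus split: split_indicator)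
  finally show "emeasure M (\<Phi> ` A)
      = (\<integral>\<^sup>+x. ennreal (\<rho> powi (if x \<in> S then 1 else - 1)) * indicator A x \<partial>M)" .
qed

theorem theorem12:
  fixes M :: "'a measure" and T \<Phi> :: "'a \<Rightarrow> 'a" and S :: "'a set" and \<rho> :: real
  assumes "prob_space M" and "nonatomic M"
    and "measure_preserving_transformation M T"
    and "scaling_involution M \<Phi> S"
    and "\<rho> = scaling_ratio M \<Phi> S"
  shows "ergodic (maharam_measure M \<rho>) (maharam_extension \<Phi> T S) \<longleftrightarrow>
     ergodic M (reciprocal_transformation \<Phi> T) \<and>
     krieger_type_III M (reciprocal_transformation \<Phi> T) (1 / \<rho>)"
proof -
  interpret prob_space M by fact
  define c where "c = (\<lambda>x. if T x \<in> S then 1 else - 1 :: int)"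
  have "0 < measure M S" "measure M S < measure M (\<Phi> ` S)"
    using assms(4) by (auto simp: scaling_involution_def)
  then have "1 < \<rho>"
    unfolding assms(5) scaling_ratio_def by simp
  then have "0 < \<rho>" by simp
  with log_jacobian_comp[OF this
      log_jacobian_scaling_involution[OF finite_measure_axioms assms(4,5) this]
      log_jacobian_measure_preserving[OF assms(3)]]
  have "log_jacobian M \<rho> (reciprocal_transformation \<Phi> T)
      (the_inv_into (space M) (reciprocal_transformation \<Phi> T)) c"
    by (intro log_jacobian_the_inv_into) (simp add: reciprocal_transformation_def comp_def c_def)
  then interpret log_jacobian_cocycle M \<rho> "reciprocal_transformation \<Phi> T" c
    using \<open>1 < \<rho>\<close> by unfold_locales
  have "maharam_extension \<Phi> T S = skew_product (reciprocal_transformation \<Phi> T) c"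
    by (auto simp: maharam_extension_def skew_product_def c_def fun_eq_iff)
  moreover have "\<not> (AE x in M. False)" by (simp add: AE_False)
  ultimately show ?thesis
    using krieger_type_III_iff ergodic_skew_product_iff by (simp only:) blast
qed

end
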